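(* $\tilde{\mathcal{M}}=ex(\mathcal{M})$; that is, the set of extreme points of $\mathcal{M}$ is exactly $\tilde{\mathcal{M}}$.
   Context: $L^\infty([1,\infty))$ is the space of real essentially bounded measurable functions on $[1,\infty)$. $\mathcal{M}$ is the set of linear functionals $\psi$ on $L^\infty([1,\infty))$ with $\psi(f)\le\limsup_{x\to\infty}\frac1x\int_1^xf(t)\,dt$ for all $f$. $\tilde{\mathcal{M}}$ is the set of functionals $\psi^{\mathcal{U}}(f)=\mathcal{U}\text{-}\lim_x\frac1x\int_1^xf(t)\,dt$ with $\mathcal{U}$ an ultrafilter on $[1,\infty)$ containing no bounded set ($\mathcal{U}\text{-}\lim$ is the limit along $\mathcal{U}$). $ex(\mathcal{M})$ is the set of extreme points of $\mathcal{M}$. *)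

theory Defs
  imports "HOL-Analysis.Analysis" "HOL-Library.Function_Algebras"
begin

text \<open>
  Pointwise scalar multiplication completes the pointwise vector space structure on functions, so
  that functionals form a real vector space and \<open>(extreme_point_of)\<close> applies to sets of them.
\<close>

instantiation "fun" :: (type, real_vector) real_vector
begin

definition scaleR_fun_def: "c *\<^sub>R f = (\<lambda>x. c *\<^sub>R f x)"

instance
  by standard (simp_all add: scaleR_fun_def fun_eq_iff scaleR_add_right scaleR_add_left)

end

lemma scaleR_fun_apply [simp]: "(c *\<^sub>R f) x = c *\<^sub>R f x"
  by (simp add: scaleR_fun_def)


text \<open>
  Representatives are total functions \<open>real \<Rightarrow> real\<close>; everything is relative to
  \<open>lebesgue_on {1..}\<close>, so their values off \<open>{1..}\<close> are irrelevant.
\<close>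

definition ess_bounded :: "(real \<Rightarrow> real) \<Rightarrow> bool" where
  "ess_bounded f \<longleftrightarrow>
     f \<in> borel_measurable (lebesgue_on {1..}) \<and> (\<exists>C. AE t in lebesgue_on {1..}. \<bar>f t\<bar> \<le> C)"

definition linf_rel :: "(real \<Rightarrow> real) \<Rightarrow> (real \<Rightarrow> real) \<Rightarrow> bool" where
  "linf_rel f g \<longleftrightarrow> ess_bounded f \<and> ess_bounded g \<and> (AE t in lebesgue_on {1..}. f t = g t)"

lemma ess_bounded_zero: "ess_bounded (\<lambda>t. 0)"
  unfolding ess_bounded_def by (auto intro!: exI[of _ 0])

lemma ess_bounded_add:
  assumes "ess_bounded f" "ess_bounded g"
  shows "ess_bounded (\<lambda>t. f t + g t)"
proof -
  obtain C D where "AE t in lebesgue_on {1..}. \<bar>f t\<bar> \<le> C" "AE t in lebesgue_on {1..}. \<bar>g t\<bar> \<le> D"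
    using assms unfolding ess_bounded_def by blast
  then have "AE t in lebesgue_on {1..}. \<bar>f t + g t\<bar> \<le> C + D"
    by eventually_elim linarith
  with assms show ?thesis
    unfolding ess_bounded_def by auto
qed

lemma ess_bounded_cmult:
  assumes "ess_bounded f"
  shows "ess_bounded (\<lambda>t. c * f t)"
proof -
  obtain C where "AE t in lebesgue_on {1..}. \<bar>f t\<bar> \<le> C"
    using assms unfolding ess_bounded_def by blast
  then have "AE t in lebesgue_on {1..}. \<bar>c * f t\<bar> \<le> \<bar>c\<bar> * C"
    by eventually_elim (simp add: abs_mult mult_left_mono)
  with assms show ?thesis
    unfolding ess_bounded_def by auto
qed

lemma part_equivp_linf_rel: "part_equivp linf_rel"
proof (rule part_equivpI)
  show "\<exists>f. linf_rel f f"
    using ess_bounded_zero by (auto simp: linf_rel_def)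
  show "symp linf_rel"
    by (auto simp: symp_def linf_rel_def elim: eventually_mono)
  show "transp linf_rel"
  proof (rule transpI)
    fix f g h assume "linf_rel f g" "linf_rel g h"
    moreover from this have "AE t in lebesgue_on {1..}. f t = h t"
      unfolding linf_rel_def by (auto elim: eventually_elim2)
    ultimately show "linf_rel f h"
      unfolding linf_rel_def by blast
  qed
qed

quotient_type linf = "real \<Rightarrow> real" / partial: linf_rel
  by (rule part_equivp_linf_rel)

instantiation linf :: real_vector
begin

lift_definition zero_linf :: linf is "\<lambda>t. 0"
  by (simp add: linf_rel_def ess_bounded_zero)

lift_definition plus_linf :: "linf \<Rightarrow> linf \<Rightarrow> linf" is "\<lambda>f g t. f t + g t"
proof -
  fix f f' g g' assume *: "linf_rel f f'" "linf_rel g g'"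
  then have "AE t in lebesgue_on {1..}. f t = f' t" "AE t in lebesgue_on {1..}. g t = g' t"
    by (simp_all add: linf_rel_def)
  then have "AE t in lebesgue_on {1..}. f t + g t = f' t + g' t"
    by eventually_elim simp
  with * show "linf_rel (\<lambda>t. f t + g t) (\<lambda>t. f' t + g' t)"
    by (simp add: linf_rel_def ess_bounded_add)
qed

lift_definition scaleR_linf :: "real \<Rightarrow> linf \<Rightarrow> linf" is "\<lambda>c f t. c * f t"
proof -
  fix c f f' assume *: "linf_rel f f'"
  then have "AE t in lebesgue_on {1..}. f t = f' t"
    by (simp add: linf_rel_def)
  then have "AE t in lebesgue_on {1..}. c * f t = c * f' t"
    by eventually_elim simp
  with * show "linf_rel (\<lambda>t. c * f t) (\<lambda>t. c * f' t)"
    by (simp add: linf_rel_def ess_bounded_cmult)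
qed

definition uminus_linf :: "linf \<Rightarrow> linf" where
  "uminus_linf f = (-1) *\<^sub>R f"

definition minus_linf :: "linf \<Rightarrow> linf \<Rightarrow> linf" where
  "minus_linf f g = f + (- g)"

lemma linf_rel_eqI: "ess_bounded f \<Longrightarrow> f = g \<Longrightarrow> linf_rel f g"
  by (simp add: linf_rel_def)

instance
proof
  fix a b c :: linf and r s :: real
  note rel = linf_rel_eqI ess_bounded_zero ess_bounded_add ess_bounded_cmult
  show "a + b + c = a + (b + c)"
    by transfer (rule rel, intro rel, simp_all add: linf_rel_def fun_eq_iff)
  show "a + b = b + a"
    by transfer (rule rel, intro rel, simp_all add: linf_rel_def fun_eq_iff)
  show "0 + a = a"
    by transfer (rule rel, intro rel, simp_all add: linf_rel_def fun_eq_iff)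
  show "- a + a = 0"
    unfolding uminus_linf_def
    by transfer (rule rel, intro rel, simp_all add: linf_rel_def fun_eq_iff)
  show "a - b = a + - b"
    by (rule minus_linf_def)
  show "r *\<^sub>R (a + b) = r *\<^sub>R a + r *\<^sub>R b"
    by transfer (rule rel, intro rel, simp_all add: linf_rel_def fun_eq_iff algebra_simps)
  show "(r + s) *\<^sub>R a = r *\<^sub>R a + s *\<^sub>R a"
    by transfer (rule rel, intro rel, simp_all add: linf_rel_def fun_eq_iff algebra_simps)
  show "r *\<^sub>R s *\<^sub>R a = (r * s) *\<^sub>R a"
    by transfer (rule rel, intro rel, simp_all add: linf_rel_def fun_eq_iff)
  show "1 *\<^sub>R a = a"
    by transfer (rule rel, intro rel, simp_all add: linf_rel_def fun_eq_iff)
qed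

end

lemma ess_bounded_measurable_lebesgue:
  assumes "ess_bounded f"
  shows "(\<lambda>t. indicator {1..x} t *\<^sub>R f t) \<in> borel_measurable lebesgue"
proof -
  have "(\<lambda>t. indicator {1..} t *\<^sub>R f t) \<in> borel_measurable lebesgue"
    using assms by (simp add: ess_bounded_def borel_measurable_restrict_space_iff)
  from borel_measurable_scaleR[OF borel_measurable_indicator[of "{1..x}" lebesgue] this]
  have "(\<lambda>t. indicator {1..x} t *\<^sub>R (indicator {1..} t *\<^sub>R f t)) \<in> borel_measurable lebesgue"
    by simp
  moreover have "(\<lambda>t. indicator {1..x} t *\<^sub>R (indicator {1..} t *\<^sub>R f t)) =
      (\<lambda>t. indicator {1..x} t *\<^sub>R f t)"
    by (auto simp: indicator_def)
  ultimately show ?thesis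
    by simp
qed

lift_definition average :: "linf \<Rightarrow> real \<Rightarrow> real"
  is "\<lambda>f x. 1 / x * (LINT t:{1..x}|lebesgue. f t)"
proof -
  fix f g assume *: "linf_rel f g"
  then have "AE t in lebesgue. t \<in> {1..} \<longrightarrow> f t = g t"
    by (simp add: linf_rel_def AE_restrict_space_iff)
  then have "AE t in lebesgue. indicator {1..x} t *\<^sub>R f t = indicator {1..x} t *\<^sub>R g t" for x
    by eventually_elim (auto simp: indicator_def)
  with * show "(\<lambda>x. 1 / x * (LINT t:{1..x}|lebesgue. f t)) = (\<lambda>x. 1 / x * (LINT t:{1..x}|lebesgue. g t))"
    unfolding set_lebesgue_integral_def linf_rel_def
    by (intro ext arg_cong2[where f="(*)"] refl integral_cong_AE ess_bounded_measurable_lebesgue) auto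
qed

lemma average_bounded: "\<exists>C. \<forall>x\<ge>1. \<bar>average f x\<bar> \<le> C"
proof transfer
  fix f assume "linf_rel f f"
  then have f: "ess_bounded f"
    by (simp add: linf_rel_def)
  then obtain C where "AE t in lebesgue_on {1..}. \<bar>f t\<bar> \<le> C"
    unfolding ess_bounded_def by blast
  then have C: "AE t in lebesgue. t \<in> {1..} \<longrightarrow> \<bar>f t\<bar> \<le> C"
    by (simp add: AE_restrict_space_iff)
  have "\<bar>1 / x * (LINT t:{1..x}|lebesgue. f t)\<bar> \<le> \<bar>C\<bar>" if x: "x \<ge> 1" for x
  proof -
    have "\<bar>LINT t|lebesgue. indicator {1..x} t *\<^sub>R f t\<bar> \<le> (LINT t|lebesgue. \<bar>C\<bar> * indicator {1..x} t)"
    proof (rule order_trans[OF integral_abs_bound integral_mono_AE'])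
      have "integrable lebesgue (indicator {1..x} :: real \<Rightarrow> real)"
        by (rule integrable_real_indicator) (use x in auto)
      then show "integrable lebesgue (\<lambda>t. \<bar>C\<bar> * indicator {1..x} t)"
        by simp
      show "AE t in lebesgue. \<bar>indicator {1..x} t *\<^sub>R f t\<bar> \<le> \<bar>C\<bar> * indicator {1..x} t"
        using C by eventually_elim (auto simp: indicator_def)
    qed simp
    also have "\<dots> = \<bar>C\<bar> * (x - 1)"
      using x by simp
    also have "\<dots> \<le> \<bar>C\<bar> * x"
      by (intro mult_left_mono) auto
    finally show ?thesis
      using x by (simp add: set_lebesgue_integral_def abs_mult field_simps)
  qed
  then show "\<exists>C. \<forall>x\<ge>1. \<bar>1 / x * (LINT t:{1..x}|lebesgue. f t)\<bar> \<le> C"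
    by blast
qed

definition \<M> :: "(linf \<Rightarrow> real) set" where
  "\<M> = {\<psi>. linear \<psi> \<and> (\<forall>f. ereal (\<psi> f) \<le> Limsup at_top (\<lambda>x. ereal (average f x)))}"

text \<open>
  An ultrafilter on a set \<open>X\<close> is represented by the library's filters on the ambient type that
  contain \<open>X\<close>; \<open>eventually (\<lambda>x. x \<in> A) U\<close> means that \<open>A\<close> belongs to \<open>U\<close>.
\<close>

definition ultrafilter_on :: "'a set \<Rightarrow> 'a filter \<Rightarrow> bool" where
  "ultrafilter_on X U \<longleftrightarrow> U \<noteq> bot \<and> U \<le> principal X \<and>
     (\<forall>A\<subseteq>X. eventually (\<lambda>x. x \<in> A) U \<or> eventually (\<lambda>x. x \<in> X - A) U)"

definition ultralimit_mean :: "real filter \<Rightarrow> linf \<Rightarrow> real" where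
  "ultralimit_mean U f = Lim U (average f)"

text \<open>
  The limit in \<open>ultralimit_mean\<close> exists whenever \<open>U\<close> is an ultrafilter on \<open>{1..}\<close>.
\<close>

lemma tendsto_ultralimit_mean:
  assumes U: "ultrafilter_on {1..} U"
  shows "(average f \<longlongrightarrow> ultralimit_mean U f) U"
proof -
  have 1: "eventually (\<lambda>x. x \<ge> 1) U"
    using U by (simp add: ultrafilter_on_def le_principal)
  have ultra: "eventually P U \<or> eventually (\<lambda>x. \<not> P x) U" for P
  proof -
    have "{x. 1 \<le> x \<and> P x} \<subseteq> {1..}"
      by auto
    then have "eventually (\<lambda>x. x \<in> {x. 1 \<le> x \<and> P x}) U \<or>
        eventually (\<lambda>x. x \<in> {1..} - {x. 1 \<le> x \<and> P x}) U"
      using U unfolding ultrafilter_on_def by (elim conjE allE impE)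
    then show ?thesis
      by (rule disj_forward; elim eventually_mono) simp_all
  qed
  obtain C where "\<forall>x\<ge>1. \<bar>average f x\<bar> \<le> C"
    using average_bounded by blast
  with 1 have "eventually (\<lambda>y. y \<in> cball 0 C) (filtermap (average f) U)"
    by (auto simp: eventually_filtermap elim!: eventually_mono)
  moreover have "filtermap (average f) U \<noteq> bot"
    using U by (simp add: ultrafilter_on_def filtermap_bot_iff)
  ultimately obtain l where l: "inf (nhds l) (filtermap (average f) U) \<noteq> bot"
    using compact_cball[of 0 C] unfolding compact_filter by blast
  have "(average f \<longlongrightarrow> l) U"
  proof (rule topological_tendstoI, rule ccontr)
    fix S assume S: "open S" "l \<in> S" "\<not> eventually (\<lambda>x. average f x \<in> S) U"
    then have "eventually (\<lambda>y. y \<notin> S) (filtermap (average f) U)"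
      using ultra[of "\<lambda>x. average f x \<in> S"] by (simp add: eventually_filtermap)
    moreover have "eventually (\<lambda>y. y \<in> S) (nhds l)"
      using S by (rule_tac eventually_nhds_in_open)
    ultimately have "eventually (\<lambda>y. False) (inf (nhds l) (filtermap (average f) U))"
      unfolding eventually_inf by blast
    with l show False
      by (simp add: trivial_limit_def)
  qed
  with U show ?thesis
    unfolding ultralimit_mean_def by (metis tendsto_Lim ultrafilter_on_def)
qed

definition \<M>tilde :: "(linf \<Rightarrow> real) set" where
  "\<M>tilde = {ultralimit_mean U |U. ultrafilter_on {1..} U \<and>
     (\<forall>B\<subseteq>{1..}. bounded B \<longrightarrow> \<not> eventually (\<lambda>x. x \<in> B) U)}"

end

theory Submission
  imports Defs
begin

text \<open>
  The averages \<open>x \<mapsto> 1 / x \<integral>\<^sub>1\<^sup>x f\<close> of bounded functions are closed under multiplication, and the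
  functionals in \<open>\<M>\<close> are the normalised positive functionals on this algebra that ignore bounded
  sets. An extreme functional \<open>\<psi>\<close> is therefore multiplicative, so for every \<open>f\<close> it vanishes on the
  square of \<open>f - \<psi> f\<close>. Finitely many averages thus come simultaneously and arbitrarily far out
  close to their \<open>\<psi>\<close>-values, and an ultrafilter containing all these sets represents \<open>\<psi>\<close>.
  Conversely, the limit along an ultrafilter vanishes on the square of \<open>f\<close> minus its limit; by
  positivity the same is true of both terms of any convex decomposition, which forces them to agree.
\<close>

section \<open>Averages of representatives: the square of an average is again an average\<close>

definition mean :: "(real \<Rightarrow> real) \<Rightarrow> real \<Rightarrow> real" where
  "mean f x = 1 / x * (LINT t:{1..x}|lebesgue. f t)"

text \<open>Passes to the integral for which the fundamental theorem of calculus is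
  available.\<close>

lemma mean_eq_integral:
  assumes "continuous_on UNIV g" "t \<ge> 1"
  shows "t * mean g t = integral {1..t} g"
proof -
  have "g absolutely_integrable_on {1..t}"
    by (rule absolutely_integrable_continuous_real) (use assms continuous_on_subset in auto)
  then show ?thesis
    using assms(2) by (simp add: mean_def set_lebesgue_integral_eq_integral)
qed

lemma has_real_derivative_mean:
  assumes g: "continuous_on UNIV g" and t: "t \<in> {1..x}"
  shows "((\<lambda>t. t * mean g t) has_real_derivative g t) (at t within {1..x})"
proof -
  have "((\<lambda>t. integral {1..t} g) has_real_derivative g t) (at t within {1..x})"
    by (rule integral_has_real_derivative) (use g t continuous_on_subset in auto)
  then show ?thesis
    using t mean_eq_integral[OF g]
    by (auto intro: has_field_derivative_transform_within[where d=1])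
qed

lemma continuous_on_mean:
  assumes g: "continuous_on UNIV g"
  shows "continuous_on {1..} (mean g)"
proof -
  have "continuous_on {1..} (\<lambda>t. t * mean g t)"
    unfolding continuous_on_eq_continuous_within
  proof
    fix t :: real assume t: "t \<in> {1..}"
    \<comment> \<open>Continuity is local, so the half line may be cut to a compact interval on
      which the derivative is known; ending it at \<open>t + 1\<close> keeps \<open>t\<close> away
      from the cut.\<close>
    have "at t within {1..} = at t within {1..t + 1}"
      by (rule at_within_nhd[of t "{..<t + 1}"]) auto
    then show "continuous (at t within {1..}) (\<lambda>t. t * mean g t)"
      using DERIV_continuous[OF has_real_derivative_mean[OF g, of t "t + 1"]] t by simp
  qed
  then have "continuous_on {1..} (\<lambda>t. t * mean g t / t)"
    by (rule continuous_on_divide) (auto intro: continuous_intros)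
  then show ?thesis
    by (rule continuous_on_eq) auto
qed

text \<open>With \<open>F = mean g\<close>, the quotient rule for \<open>(t F)^2 / t\<close> yields
  exactly the integrand, and the boundary term at 1 vanishes because \<open>F 1 = 0\<close>.\<close>

lemma mean_square_continuous:
  assumes g: "continuous_on UNIV g" and x: "x \<ge> 1"
  shows "mean (\<lambda>t. 2 * g t * mean g t - (mean g t)\<^sup>2) x = (mean g x)\<^sup>2"
proof -
  let ?h = "\<lambda>t. 2 * g t * mean g t - (mean g t)\<^sup>2"
  have "((\<lambda>t. (t * mean g t)\<^sup>2 / t) has_vector_derivative ?h t) (at t within {1..x})"
    if "t \<in> {1..x}" for t
    unfolding has_real_derivative_iff_has_vector_derivative[symmetric]
    by (rule DERIV_cong[OF DERIV_divide[OF DERIV_power[OF has_real_derivative_mean[OF g that]]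
            DERIV_ident]])
      (use that in \<open>auto simp: field_simps power2_eq_square\<close>)
  from fundamental_theorem_of_calculus[OF x this]
  have "integral {1..x} ?h = (x * mean g x)\<^sup>2 / x - (1 * mean g 1)\<^sup>2 / 1"
    by (intro integral_unique) simp
  moreover have "mean g 1 = 0"
    using mean_eq_integral[OF g, of 1] by simp
  moreover have "?h absolutely_integrable_on {1..x}"
    using g x
    by (intro absolutely_integrable_continuous_real continuous_intros
        continuous_on_subset[OF continuous_on_mean[OF g]] continuous_on_subset[OF g]) auto
  ultimately show ?thesis
    using x unfolding mean_def[of ?h]
    by (simp add: set_lebesgue_integral_eq_integral power2_eq_square)
qed

text \<open>Dominated convergence on \<open>{1..x}\<close>, where constants are integrable.\<close>

lemma mean_tendsto:
  assumes f: "\<And>n. f n \<in> borel_measurable (lebesgue_on {1..x})"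
    and lim: "AE t in lebesgue_on {1..x}. (\<lambda>n. f n t) \<longlonglongrightarrow> g t"
    and g: "g \<in> borel_measurable (lebesgue_on {1..x})"
    and bound: "\<And>n. AE t in lebesgue_on {1..x}. \<bar>f n t\<bar> \<le> C"
  shows "(\<lambda>n. mean (f n) x) \<longlonglongrightarrow> mean g x"
proof -
  have "(\<lambda>n. integral\<^sup>L (lebesgue_on {1..x}) (f n)) \<longlonglongrightarrow> integral\<^sup>L (lebesgue_on {1..x}) g"
  proof (rule integral_dominated_convergence[where w="\<lambda>_. C"])
    show "integrable (lebesgue_on {1..x}) (\<lambda>_. C)"
      by (simp add: finite_measure.integrable_const finite_measure_lebesgue_on)
  qed (use assms in auto)
  then show ?thesis
    unfolding mean_def set_lebesgue_integral_def
    by (intro tendsto_intros) (simp add: integral_restrict_space)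
qed

lemma abs_mean_le:
  assumes bound: "\<And>t. \<bar>f t\<bar> \<le> C" and x: "x \<ge> 1"
  shows "\<bar>mean f x\<bar> \<le> C"
proof -
  have C: "C \<ge> 0"
    using bound[of 0] by linarith
  have "\<bar>LINT t|lebesgue. indicator {1..x} t *\<^sub>R f t\<bar> \<le> (LINT t|lebesgue. C * indicator {1..x} t)"
  proof (rule order_trans[OF integral_abs_bound integral_mono_AE'])
    have "integrable lebesgue (indicator {1..x} :: real \<Rightarrow> real)"
      by (rule integrable_real_indicator) (use x in auto)
    then show "integrable lebesgue (\<lambda>t. C * indicator {1..x} t)"
      by (cases "1 \<le> x") (auto intro!: integrable_mult_right integrable_real_indicator)
  qed (use bound C in \<open>auto simp: indicator_def\<close>)
  also have "\<dots> \<le> C * x"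
    using x C by (simp add: mult_left_mono)
  finally show ?thesis
    using x by (simp add: mean_def set_lebesgue_integral_def abs_mult field_simps)
qed

lemma mean_cong_AE:
  assumes "ess_bounded f" "ess_bounded g" "AE t in lebesgue_on {1..}. f t = g t"
  shows "mean f = mean g"
proof -
  from assms(3) have "AE t in lebesgue. t \<in> {1..} \<longrightarrow> f t = g t"
    by (simp add: AE_restrict_space_iff)
  then have "AE t in lebesgue. indicator {1..x} t *\<^sub>R f t = indicator {1..x} t *\<^sub>R g t" for x
    by eventually_elim (auto simp: indicator_def)
  with assms show ?thesis
    unfolding mean_def set_lebesgue_integral_def
    by (intro ext arg_cong2[where f="(*)"] refl integral_cong_AE ess_bounded_measurable_lebesgue) auto
qed

text \<open>
  With \<open>F = mean f\<close>, the function \<open>x F\<^sup>2 = (x F)\<^sup>2 / x\<close> has the derivative \<open>2 f F - F\<^sup>2\<close> almost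
  everywhere. Approximation by continuous functions avoids Lebesgue's differentiation theorem.
\<close>

lemma mean_square_bounded:
  assumes f: "f \<in> borel_measurable (lebesgue_on {1..})" and C: "\<And>t. \<bar>f t\<bar> \<le> C"
  defines "h \<equiv> \<lambda>t. 2 * f t * mean f t - (mean f t)\<^sup>2"
  shows "ess_bounded h" and "x \<ge> 1 \<Longrightarrow> mean h x = (mean f x)\<^sup>2"
proof -
  have C0: "C \<ge> 0"
    using C[of 0] by linarith
  obtain N g where N: "negligible N" and cont: "\<And>n::nat. continuous_on UNIV (g n)"
    and lim: "\<And>t. t \<notin> N \<Longrightarrow> (\<lambda>n. g n t) \<longlonglongrightarrow> (if t \<in> {1..} then f t else 0)"
    using f measurable_on_iff_borel_measurable[of "{1..}" f] unfolding measurable_on_def by auto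
  \<comment> \<open>Truncating at \<open>C\<close> does not change the limit, as \<open>f\<close> is
    bounded by \<open>C\<close>, and supplies the uniform bound for dominated convergence.\<close>
  define k where "k n t = max (- C) (min C (g n t))" for n t
  have k: "continuous_on UNIV (k n)" for n
    unfolding k_def by (intro continuous_intros cont)
  have k_bound: "\<bar>k n t\<bar> \<le> C" for n t
    using C0 by (auto simp: k_def)
  have "(\<lambda>n. k n t) \<longlonglongrightarrow> max (- C) (min C (f t))" if "t \<notin> N" "t \<ge> 1" for t
    unfolding k_def using lim[OF that(1)] that(2) by (intro tendsto_intros) simp
  moreover have "max (- C) (min C (f t)) = f t" for t
    using C[of t] by linarith
  ultimately have k_lim: "(\<lambda>n. k n t) \<longlonglongrightarrow> f t" if "t \<notin> N" "t \<ge> 1" for t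
    using that by simp
  have "AE t in lebesgue. t \<notin> N"
    using N by (simp add: negligible_iff_null_sets AE_not_in)
  then have k_AE: "AE t in lebesgue_on {1..x}. (\<lambda>n. k n t) \<longlonglongrightarrow> f t" for x
    by (auto simp: AE_restrict_space_iff k_lim elim!: eventually_mono)
  have meas: "u \<in> borel_measurable (lebesgue_on {1..x})"
    if "u \<in> borel_measurable (lebesgue_on {1..})" for u :: "real \<Rightarrow> real" and x
    by (rule measurable_restrict_mono[OF that]) auto
  have k_meas: "k n \<in> borel_measurable (lebesgue_on {1..x})" for n x
    by (intro continuous_imp_measurable_on_sets_lebesgue continuous_on_subset[OF k]) auto
  have mean_lim: "(\<lambda>n. mean (k n) x) \<longlonglongrightarrow> mean f x" for x
    by (rule mean_tendsto[where C=C]) (use k_meas k_AE k_bound meas[OF f] in auto)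
  have mean_k_meas: "mean (k n) \<in> borel_measurable (lebesgue_on {1..})" for n
    by (intro continuous_imp_measurable_on_sets_lebesgue continuous_on_mean k) auto
  have mean_meas: "mean f \<in> borel_measurable (lebesgue_on {1..})"
    by (rule borel_measurable_LIMSEQ_real[OF mean_lim mean_k_meas])
  have h_meas: "h \<in> borel_measurable (lebesgue_on {1..})"
    unfolding h_def by (intro borel_measurable_diff borel_measurable_times borel_measurable_power
        borel_measurable_const f mean_meas)
  \<comment> \<open>Serves both \<open>f\<close> and its approximants; the constant is
    \<open>2 * C * C + C * C\<close>.\<close>
  have bound: "\<bar>2 * u t * mean u t - (mean u t)\<^sup>2\<bar> \<le> 3 * C\<^sup>2"
    if u: "\<And>t. \<bar>u t\<bar> \<le> C" and t: "t \<ge> 1" for u :: "real \<Rightarrow> real" and t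
  proof -
    have "\<bar>u t * mean u t\<bar> \<le> C * C"
      unfolding abs_mult using u[of t] abs_mean_le[OF u t] C0 by (intro mult_mono) auto
    moreover have "\<bar>mean u t * mean u t\<bar> \<le> C * C"
      unfolding abs_mult using abs_mean_le[OF u t] C0 by (intro mult_mono) auto
    ultimately show ?thesis
      unfolding power2_eq_square mult.assoc by linarith
  qed
  show "ess_bounded h"
    unfolding ess_bounded_def
  proof (intro conjI h_meas exI)
    show "AE t in lebesgue_on {1..}. \<bar>h t\<bar> \<le> 3 * C\<^sup>2"
      unfolding h_def by (rule AE_I2) (use bound[OF C] in auto)
  qed
  show "mean h x = (mean f x)\<^sup>2" if x: "x \<ge> 1"
  \<comment> \<open>The squares \<open>(mean (k n) x)^2\<close> are also the means of
    \<open>?h n\<close>, so they have both sides as limits.\<close>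
  proof (rule LIMSEQ_unique)
    show "(\<lambda>n. (mean (k n) x)\<^sup>2) \<longlonglongrightarrow> (mean f x)\<^sup>2"
      by (intro tendsto_intros mean_lim)
    let ?h = "\<lambda>n t. 2 * k n t * mean (k n) t - (mean (k n) t)\<^sup>2"
    have "(\<lambda>n. mean (?h n) x) \<longlonglongrightarrow> mean h x"
    proof (rule mean_tendsto)
      show "?h n \<in> borel_measurable (lebesgue_on {1..x})" for n
        by (intro borel_measurable_diff borel_measurable_times borel_measurable_power
            borel_measurable_const k_meas meas mean_k_meas)
      show "AE t in lebesgue_on {1..x}. (\<lambda>n. ?h n t) \<longlonglongrightarrow> h t"
        using k_AE unfolding h_def by eventually_elim (intro tendsto_intros mean_lim)
      show "AE t in lebesgue_on {1..x}. \<bar>?h n t\<bar> \<le> 3 * C\<^sup>2" for n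
        by (rule AE_I2) (use bound[OF k_bound] in auto)
    qed (rule meas[OF h_meas])
    then show "(\<lambda>n. (mean (k n) x)\<^sup>2) \<longlonglongrightarrow> mean h x"
      using mean_square_continuous[OF k x] by simp
  qed
qed

section \<open>The algebra of averages of classes\<close>

lemma average_abs_linf: "ess_bounded f \<Longrightarrow> average (abs_linf f) = mean f"
  by (simp add: average.abs_eq linf_rel_def mean_def[abs_def])

lemma linf_exhaust:
  obtains f where "F = abs_linf f" "ess_bounded f"
  using linf.abs_induct[of "\<lambda>F. \<exists>f. F = abs_linf f \<and> ess_bounded f" F]
  by (auto simp: linf_rel_def)

text \<open>The interval of integration is empty here, so identities between averages can be stated
  as equations of functions on all reals.\<close>

lemma average_less_one: "x < 1 \<Longrightarrow> average f x = 0"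
  by transfer (simp add: set_lebesgue_integral_def)

lemma exists_average_square: "\<exists>h. average h = (\<lambda>x. (average f x)\<^sup>2)"
proof -
  obtain r where r: "f = abs_linf r" "ess_bounded r"
    by (rule linf_exhaust)
  then obtain C where C: "AE t in lebesgue_on {1..}. \<bar>r t\<bar> \<le> C"
    unfolding ess_bounded_def by blast
  \<comment> \<open>Another representative of the same class, now bounded at every point as
    \<open>mean_square_bounded\<close> demands.\<close>
  define u where "u t = max (- \<bar>C\<bar>) (min \<bar>C\<bar> (r t))" for t
  have u_meas: "u \<in> borel_measurable (lebesgue_on {1..})"
    using r unfolding u_def ess_bounded_def by auto
  have u_bound: "\<bar>u t\<bar> \<le> \<bar>C\<bar>" for t
    by (auto simp: u_def)
  have u: "ess_bounded u"
    unfolding ess_bounded_def using u_meas u_bound by auto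
  have "AE t in lebesgue_on {1..}. r t = u t"
    using C by eventually_elim (auto simp: u_def)
  then have eq: "average f = mean u"
    unfolding r(1) average_abs_linf[OF r(2)] by (rule mean_cong_AE[OF r(2) u])
  define h where "h t = 2 * u t * mean u t - (mean u t)\<^sup>2" for t
  have h: "ess_bounded h" "\<And>x. x \<ge> 1 \<Longrightarrow> mean h x = (mean u x)\<^sup>2"
    unfolding h_def using mean_square_bounded[OF u_meas u_bound] by blast+
  have "average (abs_linf h) x = (average f x)\<^sup>2" for x
  proof (cases "x \<ge> 1")
    case True
    then show ?thesis
      by (simp add: average_abs_linf h eq)
  qed (simp add: average_less_one)
  then show ?thesis
    by blast
qed

lemma integrable_ess_bounded:
  assumes "ess_bounded f"
  shows "set_integrable lebesgue {1..x} f"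
proof -
  obtain C where "AE t in lebesgue_on {1..}. \<bar>f t\<bar> \<le> C"
    using assms unfolding ess_bounded_def by blast
  then have C: "AE t in lebesgue. t \<in> {1..} \<longrightarrow> \<bar>f t\<bar> \<le> C"
    by (simp add: AE_restrict_space_iff)
  show ?thesis
    unfolding set_integrable_def
  proof (rule Bochner_Integration.integrable_bound)
    show "integrable lebesgue (\<lambda>t. C * indicator {1..x} t)"
      by (cases "1 \<le> x") (auto intro!: integrable_mult_right integrable_real_indicator)
    show "AE t in lebesgue. norm (indicator {1..x} t *\<^sub>R f t) \<le> norm (C * indicator {1..x} t)"
      using C by eventually_elim (auto simp: indicator_def)
  qed (rule ess_bounded_measurable_lebesgue[OF assms])
qed

lemma average_add: "average (f + g) x = average f x + average g x"
proof (transfer fixing: x)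
  fix f g assume "linf_rel f f" "linf_rel g g"
  then show "1 / x * (LINT t:{1..x}|lebesgue. f t + g t) =
      1 / x * (LINT t:{1..x}|lebesgue. f t) + 1 / x * (LINT t:{1..x}|lebesgue. g t)"
    by (subst set_integral_add(2))
      (auto simp: linf_rel_def integrable_ess_bounded distrib_left)
qed

lemma average_scaleR: "average (c *\<^sub>R f) x = c * average f x"
  by transfer simp

lemma average_diff: "average (f - g) x = average f x - average g x"
  using average_add[of "f - g" g x] by simp

lemma average_minus: "average (- f) x = - average f x"
  using average_scaleR[of "-1" f x] by simp

lift_definition one_linf :: linf is "\<lambda>t. 1"
  by (auto simp: linf_rel_def ess_bounded_def intro: exI[of _ 1])

text \<open>Integration starts at 1 but the divisor is \<open>x\<close>, so \<open>one_linf\<close>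
  is a unit for the product of averages only in the limit.\<close>

lemma average_one: "x \<ge> 1 \<Longrightarrow> average one_linf x = 1 - 1 / x"
  by transfer (simp add: set_lebesgue_integral_def field_simps)

lemma tendsto_average_one: "(average one_linf \<longlongrightarrow> 1) at_top"
proof (rule Lim_transform_eventually)
  have "((\<lambda>x::real. 1 - 1 / x) \<longlongrightarrow> 1 - 0) at_top"
    by (intro tendsto_intros tendsto_divide_0[OF tendsto_const] filterlim_at_top_imp_at_infinity
        filterlim_ident)
  then show "((\<lambda>x::real. 1 - 1 / x) \<longlongrightarrow> 1) at_top"
    by simp
  show "\<forall>\<^sub>F x in at_top. 1 - 1 / x = average one_linf x"
    using eventually_ge_at_top[of 1] by eventually_elim (simp add: average_one)
qed

text \<open>Polarisation: a product is a quarter of the difference of the squares of sum and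
  difference.\<close>

lemma exists_average_product: "\<exists>h. average h = (\<lambda>x. average f x * average g x)"
proof -
  obtain p q where pq: "average p = (\<lambda>x. (average (f + g) x)\<^sup>2)" "average q = (\<lambda>x. (average (f - g) x)\<^sup>2)"
    using exists_average_square by meson
  have "average ((1 / 4) *\<^sub>R (p - q)) x = average f x * average g x" for x
    by (simp add: pq average_scaleR average_diff average_add power2_eq_square field_simps)
  then have "average ((1 / 4) *\<^sub>R (p - q)) = (\<lambda>x. average f x * average g x)"
    by blast
  then show ?thesis
    by blast
qed

text \<open>Averages are multiplied here, not functions. Elements of \<M> depend on averages only,
  so the choice of the class does not affect their values.\<close>

definition prod_linf :: "linf \<Rightarrow> linf \<Rightarrow> linf" where
  "prod_linf f g = (SOME h. average h = (\<lambda>x. average f x * average g x))"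

lemma average_prod: "average (prod_linf f g) x = average f x * average g x"
  unfolding prod_linf_def using someI_ex[OF exists_average_product[of f g]] by simp

lemmas average_simps = average_add average_diff average_minus average_scaleR average_prod

section \<open>Positivity and normalisation of the functionals in \<M>\<close>

text \<open>Trades the extended real \<open>Limsup\<close> for eventual real bounds: every real
  number above the \<open>Limsup\<close> is one.\<close>

lemma mem_\<M>_iff:
  "\<psi> \<in> \<M> \<longleftrightarrow> linear \<psi> \<and>
     (\<forall>f c. (\<forall>\<^sub>F x in at_top. average f x \<le> c) \<longrightarrow> \<psi> f \<le> c)"
proof -
  have "ereal (\<psi> f) \<le> Limsup at_top (\<lambda>x. ereal (average f x)) \<longleftrightarrow>
      (\<forall>c. (\<forall>\<^sub>F x in at_top. average f x \<le> c) \<longrightarrow> \<psi> f \<le> c)" for f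
  proof
    assume *: "ereal (\<psi> f) \<le> Limsup at_top (\<lambda>x. ereal (average f x))"
    show "\<forall>c. (\<forall>\<^sub>F x in at_top. average f x \<le> c) \<longrightarrow> \<psi> f \<le> c"
    proof (intro allI impI)
      fix c assume "\<forall>\<^sub>F x in at_top. average f x \<le> c"
      then have "Limsup at_top (\<lambda>x. ereal (average f x)) \<le> ereal c"
        by (intro Limsup_bounded) simp
      with * show "\<psi> f \<le> c"
        using order_trans ereal_less_eq(3) by blast
    qed
  next
    assume *: "\<forall>c. (\<forall>\<^sub>F x in at_top. average f x \<le> c) \<longrightarrow> \<psi> f \<le> c"
    show "ereal (\<psi> f) \<le> Limsup at_top (\<lambda>x. ereal (average f x))"
    proof (rule ccontr)
      assume "\<not> ?thesis"
      then obtain c where c: "Limsup at_top (\<lambda>x. ereal (average f x)) < ereal c" "ereal c < ereal (\<psi> f)"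
        using ereal_dense2 not_le by metis
      from Limsup_lessD[OF c(1)] have "\<forall>\<^sub>F x in at_top. average f x \<le> c"
        by eventually_elim simp
      with * c(2) show False
        by fastforce
    qed
  qed
  then show ?thesis
    unfolding \<M>_def by auto
qed

lemma \<M>_linear: "\<psi> \<in> \<M> \<Longrightarrow> linear \<psi>"
  by (simp add: mem_\<M>_iff)

lemma \<M>_le:
  assumes "\<psi> \<in> \<M>" and le: "\<forall>\<^sub>F x in at_top. average f x \<le> u x" and u: "(u \<longlongrightarrow> c) at_top"
  shows "\<psi> f \<le> c"
proof (rule field_le_epsilon)
  fix e :: real assume "e > 0"
  with u have "\<forall>\<^sub>F x in at_top. u x < c + e"
    by (intro order_tendstoD) auto
  with le have "\<forall>\<^sub>F x in at_top. average f x \<le> c + e"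
    by eventually_elim simp
  with assms(1) show "\<psi> f \<le> c + e"
    by (simp add: mem_\<M>_iff)
qed

lemma \<M>_ge:
  assumes "\<psi> \<in> \<M>" "\<forall>\<^sub>F x in at_top. u x \<le> average f x" "(u \<longlongrightarrow> c) at_top"
  shows "c \<le> \<psi> f"
  using \<M>_le[OF assms(1), of "- f" "\<lambda>x. - u x" "- c"] assms
  by (simp add: average_minus linear_neg tendsto_minus mem_\<M>_iff)

lemma \<M>_eq:
  assumes "\<psi> \<in> \<M>" "(average f \<longlongrightarrow> c) at_top"
  shows "\<psi> f = c"
  using \<M>_le[OF assms(1) _ assms(2)] \<M>_ge[OF assms(1) _ assms(2)] by (simp add: order_antisym)

lemma \<M>_one: "\<psi> \<in> \<M> \<Longrightarrow> \<psi> one_linf = 1"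
  by (rule \<M>_eq[OF _ tendsto_average_one])

text \<open>Only the behaviour of averages at infinity counts; this absorbs the defect of
  \<open>one_linf\<close> as a unit.\<close>

lemma \<M>_cong:
  assumes "\<psi> \<in> \<M>" "((\<lambda>x. average f x - average g x) \<longlongrightarrow> 0) at_top"
  shows "\<psi> f = \<psi> g"
  using \<M>_eq[OF assms(1), of "f - g" 0] assms
  by (simp add: average_diff[abs_def] linear_diff mem_\<M>_iff)

section \<open>Limits along ultrafilters are extreme points\<close>

text \<open>Each \<open>{1..c}\<close> is bounded, so the ultrafilter contains its complement and
  hence every tail.\<close>

lemma \<M>tilde_filter_le_at_top:
  fixes U :: "real filter"
  assumes U: "ultrafilter_on {1..} U" and B: "\<forall>B\<subseteq>{1..}. bounded B \<longrightarrow> \<not> eventually (\<lambda>x. x \<in> B) U"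
  shows "U \<le> at_top"
proof -
  have "eventually (\<lambda>x. c \<le> x) U" for c :: real
  proof -
    have "\<not> eventually (\<lambda>x. x \<in> {1..c}) U"
      using B[rule_format, of "{1..c}"] by auto
    then have "eventually (\<lambda>x. x \<in> {1..} - {1..c}) U"
      using U unfolding ultrafilter_on_def by (metis Icc_subset_Ici_iff order_refl)
    then show ?thesis
      by eventually_elim auto
  qed
  then have "filterlim (\<lambda>x. x) at_top U"
    by (simp add: filterlim_at_top)
  then show ?thesis
    by (simp add: filterlim_def filtermap_ident)
qed

lemma ultralimit_mean_in_\<M>:
  assumes U: "ultrafilter_on {1..} U" "U \<le> at_top"
  shows "ultralimit_mean U \<in> \<M>"
proof -
  note lim = tendsto_ultralimit_mean[OF U(1)]
  have [simp]: "U \<noteq> bot"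
    using U by (simp add: ultrafilter_on_def)
  have "ultralimit_mean U (f + g) = ultralimit_mean U f + ultralimit_mean U g" for f g
    using tendsto_add[OF lim[of f] lim[of g]] lim[of "f + g"] tendsto_unique[OF \<open>U \<noteq> bot\<close>]
    by (simp add: average_add[abs_def] fun_eq_iff)
  moreover have "ultralimit_mean U (c *\<^sub>R f) = c *\<^sub>R ultralimit_mean U f" for c f
    using tendsto_mult_left[OF lim[of f], of c] lim[of "c *\<^sub>R f"] tendsto_unique[OF \<open>U \<noteq> bot\<close>]
    by (simp add: average_scaleR[abs_def])
  ultimately have "linear (ultralimit_mean U)"
    by (rule linearI)
  moreover have "ultralimit_mean U f \<le> c" if "\<forall>\<^sub>F x in at_top. average f x \<le> c" for f c
    using tendsto_upperbound[OF lim] filter_leD[OF U(2) that] by simp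
  ultimately show ?thesis
    by (simp add: mem_\<M>_iff)
qed

lemma tendsto_average_one_le: "U \<le> at_top \<Longrightarrow> (average one_linf \<longlongrightarrow> 1) U"
  using tendsto_mono[OF _ tendsto_average_one] by blast

text \<open>Plays the part of the Cauchy-Schwarz inequality; it rests on
  \<open>t <= e + t^2 / e\<close>, applied to \<open>f\<close> and to \<open>- f\<close>.\<close>

lemma \<M>_square_eq_0:
  assumes \<psi>: "\<psi> \<in> \<M>" and 0: "\<psi> (prod_linf f f) = 0"
  shows "\<psi> f = 0"
proof -
  have le: "\<psi> g \<le> 0" if "\<psi> (prod_linf g g) = 0" for g
  proof (rule field_le_epsilon)
    fix e :: real assume e: "e > 0"
    \<comment> \<open>so \<open>\<psi>\<close> is bounded on \<open>g\<close> by \<open>e\<close> plus a multiple of its value on the square of \<open>g\<close>\<close>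
    have "t - t\<^sup>2 / e \<le> e" for t
    proof -
      \<comment> \<open>The right-hand side is \<open>4 * (t^2 - t * e + e^2)\<close>.\<close>
      have "0 \<le> (2 * t - e)\<^sup>2 + 3 * e\<^sup>2"
        by simp
      then have "t * e \<le> e\<^sup>2 + t\<^sup>2"
        by (simp add: power2_eq_square algebra_simps)
      then show ?thesis
        using e by (simp add: field_simps power2_eq_square)
    qed
    then have "\<psi> (g - (1 / e) *\<^sub>R prod_linf g g) \<le> e"
      by (intro \<M>_le[OF \<psi> _ tendsto_const]) (simp add: average_simps power2_eq_square)
    then show "\<psi> g \<le> 0 + e"
      using that by (simp add: \<M>_linear[OF \<psi>] linear_diff linear_scale)
  qed
  \<comment> \<open>Both choices are made from the same predicate, so the classes themselves
    coincide.\<close>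
  have "prod_linf (- f) (- f) = prod_linf f f"
    unfolding prod_linf_def by (simp add: average_minus)
  then have "\<psi> (- f) \<le> 0"
    using le[of "- f"] 0 by simp
  then show ?thesis
    using le[of f] 0 by (simp add: \<M>_linear[OF \<psi>] linear_neg)
qed

lemma ultralimit_mean_extreme:
  assumes U: "ultrafilter_on {1..} U" "U \<le> at_top"
  shows "ultralimit_mean U extreme_point_of \<M>"
  unfolding extreme_point_of_def
proof (intro conjI ballI notI)
  let ?\<psi> = "ultralimit_mean U"
  show \<psi>: "?\<psi> \<in> \<M>"
    by (rule ultralimit_mean_in_\<M>[OF U])
  fix a b assume a: "a \<in> \<M>" and b: "b \<in> \<M>" and "?\<psi> \<in> open_segment a b"
  then obtain u where "a \<noteq> b" and u: "0 < u" "u < 1" and eq: "?\<psi> = (1 - u) *\<^sub>R a + u *\<^sub>R b"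
    unfolding in_segment by blast
  have "a f = b f" for f
  proof -
    \<comment> \<open>Centring \<open>f\<close> at its limit makes the average of \<open>g\<close>,
      and so that of its square, tend to 0 along \<open>U\<close>.\<close>
    define g where "g = f - ?\<psi> f *\<^sub>R one_linf"
    let ?h = "prod_linf g g"
    have "(average g \<longlongrightarrow> ?\<psi> f - ?\<psi> f * 1) U"
      unfolding g_def average_diff[abs_def] average_scaleR
      by (intro tendsto_intros tendsto_ultralimit_mean[OF U(1)] tendsto_average_one_le[OF U(2)])
    then have "((\<lambda>x. average g x * average g x) \<longlongrightarrow> 0 * 0) U"
      by (intro tendsto_mult) simp_all
    then have "(average ?h \<longlongrightarrow> 0) U"
      by (simp add: average_prod[abs_def])
    then have "?\<psi> ?h = 0"
      using tendsto_ultralimit_mean[OF U(1), of ?h] U(1) tendsto_unique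
      unfolding ultrafilter_on_def by blast
    moreover have "0 \<le> a ?h" "0 \<le> b ?h"
      by (auto intro!: \<M>_ge[OF a _ tendsto_const] \<M>_ge[OF b _ tendsto_const] simp: average_prod)
    ultimately have "(1 - u) * a ?h + u * b ?h = 0" "0 \<le> (1 - u) * a ?h" "0 \<le> u * b ?h"
      using u eq by (simp_all add: fun_eq_iff)
    then have "(1 - u) * a ?h = 0" "u * b ?h = 0"
      by linarith+
    then have "a g = 0" "b g = 0"
      using u by (auto intro: \<M>_square_eq_0 a b)
    \<comment> \<open>Both values equal \<open>?\<psi> f\<close>, since \<open>a\<close> and
      \<open>b\<close> vanish on \<open>g\<close> and send \<open>one_linf\<close> to 1.\<close>
    then show ?thesis
      using \<M>_linear[OF a] \<M>_linear[OF b] \<M>_one[OF a] \<M>_one[OF b]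
      by (simp add: g_def linear_diff linear_scale)
  qed
  with \<open>a \<noteq> b\<close> show False
    by blast
qed


section \<open>Ultrafilters below a proper filter\<close>

text \<open>Finer filters are smaller in this order, so Zorn's lemma is used with the order reversed
  and a minimal proper filter is the ultrafilter.\<close>

lemma exists_ultrafilter_le:
  fixes F :: "'a filter"
  assumes F: "F \<noteq> bot"
  obtains U where "U \<noteq> bot" "U \<le> F" "\<And>A. eventually (\<lambda>x. x \<in> A) U \<or> eventually (\<lambda>x. x \<notin> A) U"
proof -
  let ?S = "{G. G \<noteq> bot \<and> G \<le> F}"
  have "\<exists>U\<in>?S. \<forall>G\<in>?S. G \<le> U \<longrightarrow> G = U"
  proof (rule predicate_Zorn)
    show "partial_order_on ?S (relation_of (\<ge>) ?S)"
      by (rule partial_order_on_relation_ofI) auto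
    fix C assume "C \<in> Chains (relation_of (\<ge>) ?S)"
    then have C: "C \<subseteq> ?S" and chain: "\<And>G H. G \<in> C \<Longrightarrow> H \<in> C \<Longrightarrow> G \<le> H \<or> H \<le> G"
      by (auto simp: Chains_def relation_of_def)
    show "\<exists>G\<in>?S. \<forall>H\<in>C. G \<le> H"
    proof (cases "C = {}")
      case False
      \<comment> \<open>A nonempty chain is directed downwards, so its infimum is proper when its
        members are.\<close>
      have "(INF G\<in>C. G) \<noteq> bot"
        using C chain by (subst INF_filter_bot_base) (fastforce simp: le_inf_iff)+
      moreover have "(INF G\<in>C. G) \<le> F"
        using False C by (auto intro: Inf_lower2)
      ultimately show ?thesis
        by (intro bexI[of _ "INF G\<in>C. G"]) (auto intro: Inf_lower)
    qed (use F in auto)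
  qed
  then obtain U where U: "U \<noteq> bot" "U \<le> F" and max: "\<And>G. G \<noteq> bot \<Longrightarrow> G \<le> U \<Longrightarrow> G = U"
    by (auto intro: order_trans)
  have "eventually (\<lambda>x. x \<notin> A) U" if "\<not> eventually (\<lambda>x. x \<in> A) U" for A
  proof -
    \<comment> \<open>If \<open>A\<close> is not in \<open>U\<close>, adding the complement of
      \<open>A\<close> keeps the filter proper; by minimality it was there already.\<close>
    have "inf U (principal (- A)) \<noteq> bot"
      using that by (simp add: trivial_limit_def eventually_inf_principal)
    then have "inf U (principal (- A)) = U"
      by (rule max) simp
    moreover have "eventually (\<lambda>x. x \<notin> A) (inf U (principal (- A)))"
      by (simp add: eventually_inf_principal)
    ultimately show ?thesis
      by (simp only:)
  qed
  with U that show thesis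
    by blast
qed

section \<open>Multiplicativity of extreme points\<close>

text \<open>The bounds keep \<open>\<psi> f\<close> strictly between 0 and 1 and make
  \<open>f\<close> and its complement nonnegative weights, so \<psi> can be conditioned on either;
  extremality forces the two conditioned functionals to agree.\<close>

lemma extreme_point_multiplicative_aux:
  assumes ext: "\<psi> extreme_point_of \<M>"
    and f: "\<forall>\<^sub>F x in at_top. 1 / 4 \<le> average f x \<and> average f x \<le> 3 / 4"
  shows "\<psi> (prod_linf f g) = \<psi> f * \<psi> g"
proof -
  have \<psi>: "\<psi> \<in> \<M>"
    using ext by (simp add: extreme_point_of_def)
  note lin = \<M>_linear[OF \<psi>]
  define p where "p = \<psi> f"
  have "1 / 4 \<le> p"
    unfolding p_def by (rule \<M>_ge[OF \<psi> eventually_mono[OF f] tendsto_const]) simp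
  moreover have "p \<le> 3 / 4"
    unfolding p_def by (rule \<M>_le[OF \<psi> eventually_mono[OF f] tendsto_const]) simp
  ultimately have p: "0 < p" "p < 1"
    by auto
  \<comment> \<open>\<open>prod_linf\<close> comes from a choice, so its linearity is obtained only
    after applying \<psi>, from the averages.\<close>
  have prod_cong: "\<psi> h = \<psi> k" if "average h = average k" for h k
    using \<M>_cong[OF \<psi>, of h k] that by simp
  have prod_add: "\<psi> (prod_linf f (g + h)) = \<psi> (prod_linf f g) + \<psi> (prod_linf f h)" for g h
    unfolding linear_add[OF lin, symmetric]
    by (rule prod_cong) (simp add: fun_eq_iff average_simps distrib_left)
  have prod_scale: "\<psi> (prod_linf f (c *\<^sub>R g)) = c * \<psi> (prod_linf f g)" for c g
  proof -
    have "\<psi> (prod_linf f (c *\<^sub>R g)) = \<psi> (c *\<^sub>R prod_linf f g)"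
      by (rule prod_cong) (simp add: fun_eq_iff average_simps)
    then show ?thesis
      by (simp add: linear_scale[OF lin])
  qed
  \<comment> \<open>\<open>\<psi>\<close> conditioned on the weights \<open>f\<close> and \<open>1 - f\<close>: it is a convex combination of the two\<close>
  define a where "a g = \<psi> (prod_linf f g) / p" for g
  define b where "b g = (\<psi> g - \<psi> (prod_linf f g)) / (1 - p)" for g
  have "a \<in> \<M>"
    unfolding mem_\<M>_iff
  proof (intro conjI allI impI)
    show "linear a"
      by (rule linearI) (simp_all add: a_def prod_add prod_scale add_divide_distrib)
    fix g c assume "\<forall>\<^sub>F x in at_top. average g x \<le> c"
    with f have "\<forall>\<^sub>F x in at_top. average (prod_linf f g - c *\<^sub>R f) x \<le> 0"
    proof eventually_elim
      case (elim x)
      then have "average f x * average g x \<le> average f x * c"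
        by (intro mult_left_mono) auto
      then show ?case
        by (simp add: average_simps mult.commute)
    qed
    then have "\<psi> (prod_linf f g - c *\<^sub>R f) \<le> 0"
      using \<psi> by (simp add: mem_\<M>_iff)
    then show "a g \<le> c"
      using p by (simp add: a_def linear_diff[OF lin] linear_scale[OF lin] p_def field_simps)
  qed
  moreover have "b \<in> \<M>"
    unfolding mem_\<M>_iff
  proof (intro conjI allI impI)
    show "linear b"
      by (rule linearI) (simp_all add: b_def prod_add prod_scale linear_add[OF lin] linear_scale[OF lin]
          add_divide_distrib diff_divide_distrib right_diff_distrib)
    fix g c assume "\<forall>\<^sub>F x in at_top. average g x \<le> c"
    \<comment> \<open>The inequality \<open>(1 - f) g <= (1 - f) c\<close> for averages is
      rearranged so that \<open>c\<close> stays a scalar, because the average of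
      \<open>one_linf\<close> is not exactly 1.\<close>
    with f have "\<forall>\<^sub>F x in at_top. average (g - prod_linf f g + c *\<^sub>R f) x \<le> c"
    proof eventually_elim
      case (elim x)
      then have "(1 - average f x) * average g x \<le> (1 - average f x) * c"
        by (intro mult_left_mono) auto
      then show ?case
        by (simp add: average_simps algebra_simps)
    qed
    then have "\<psi> (g - prod_linf f g + c *\<^sub>R f) \<le> c"
      using \<psi> by (simp add: mem_\<M>_iff)
    then show "b g \<le> c"
      using p by (simp add: b_def linear_diff[OF lin] linear_add[OF lin] linear_scale[OF lin] p_def
          field_simps)
  qed
  moreover have "\<psi> = (1 - (1 - p)) *\<^sub>R a + (1 - p) *\<^sub>R b"
    using p by (simp add: fun_eq_iff a_def b_def)
  ultimately have "a = b"
    using ext p unfolding extreme_point_of_def in_segment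
    by (metis diff_gt_0_iff_gt diff_less_eq less_add_same_cancel1)
  then have "a g = b g"
    by simp
  then show ?thesis
    using p by (simp add: a_def b_def p_def field_simps)
qed

text \<open>An affine rescaling \<open>k\<close> of \<open>f\<close> satisfies the bounds of the
  special case, and the identity is affine in \<open>f\<close>.\<close>

lemma extreme_point_multiplicative:
  assumes ext: "\<psi> extreme_point_of \<M>"
  shows "\<psi> (prod_linf f g) = \<psi> f * \<psi> g"
proof -
  have \<psi>: "\<psi> \<in> \<M>"
    using ext by (simp add: extreme_point_of_def)
  note lin = \<M>_linear[OF \<psi>]
  obtain C where C: "\<And>x. x \<ge> 1 \<Longrightarrow> \<bar>average f x\<bar> \<le> C"
    using average_bounded[of f] by blast
  \<comment> \<open>This makes the average of \<open>f\<close> over \<open>D\<close> at most 1/8 in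
    absolute value. For \<open>x >= 4\<close> the unit part of \<open>k\<close> lies between 3/8 and
    1/2, so \<open>k\<close> stays within 1/4 and 3/4.\<close>
  define D where "D = 8 * (\<bar>C\<bar> + 1)"
  have D: "D > 0"
    by (simp add: D_def)
  define k where "k = (1 / 2) *\<^sub>R one_linf + (1 / D) *\<^sub>R f"
  have bounds: "1 / 4 \<le> 1 / 2 * (1 - s) + t \<and> 1 / 2 * (1 - s) + t \<le> 3 / 4"
    if "\<bar>t\<bar> \<le> 1 / 8" "s \<le> 1 / 4" "0 \<le> s" for s t :: real
    using that by (auto simp: abs_le_iff field_simps)
  have "\<forall>\<^sub>F x in at_top. 1 / 4 \<le> average k x \<and> average k x \<le> 3 / 4"
    using eventually_ge_at_top[of 4]
  proof eventually_elim
    case (elim x)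
    have "\<bar>average f x\<bar> \<le> D / 8"
      using C[of x] elim by (simp add: D_def)
    then have "\<bar>average f x / D\<bar> \<le> 1 / 8"
      using D by (simp add: field_simps)
    moreover have "1 / x \<le> 1 / 4" "0 \<le> 1 / x"
      using elim by (simp_all add: field_simps)
    moreover have "average k x = 1 / 2 * (1 - 1 / x) + average f x / D"
      using elim by (simp add: k_def average_simps average_one)
    ultimately show ?case
      using bounds[of "average f x / D" "1 / x"] by metis
  qed
  from extreme_point_multiplicative_aux[OF ext this]
  have 1: "\<psi> (prod_linf k g) = (1 / 2 + \<psi> f / D) * \<psi> g"
    by (simp add: k_def linear_add[OF lin] linear_scale[OF lin] \<M>_one[OF \<psi>])
  have "\<psi> (prod_linf k g) = \<psi> ((1 / 2) *\<^sub>R g + (1 / D) *\<^sub>R prod_linf f g)"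
  proof (rule \<M>_cong[OF \<psi>])
    \<comment> \<open>The error is a null function times a bounded one.\<close>
    have eq: "average (prod_linf k g) x - average ((1 / 2) *\<^sub>R g + (1 / D) *\<^sub>R prod_linf f g) x =
        1 / 2 * ((average one_linf x - 1) * average g x)" for x
      by (simp add: k_def average_simps algebra_simps)
    have "((\<lambda>x. average one_linf x - 1) \<longlongrightarrow> 1 - 1) at_top"
      by (intro tendsto_intros tendsto_average_one)
    moreover obtain B where "\<forall>x\<ge>1. \<bar>average g x\<bar> \<le> B"
      using average_bounded[of g] by blast
    then have "Bfun (average g) at_top"
      by (intro BfunI[of _ B] eventually_mono[OF eventually_ge_at_top[of 1]]) simp
    ultimately have "((\<lambda>x. (average one_linf x - 1) * average g x) \<longlongrightarrow> 0) at_top"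
      unfolding tendsto_Zfun_iff by (simp add: bounded_bilinear.Zfun_prod_Bfun[OF bounded_bilinear_mult])
    from tendsto_mult_left[OF this, of "1 / 2"]
    show "((\<lambda>x. average (prod_linf k g) x -
        average ((1 / 2) *\<^sub>R g + (1 / D) *\<^sub>R prod_linf f g) x) \<longlongrightarrow> 0) at_top"
      unfolding eq by simp
  qed
  with 1 show ?thesis
    using D by (simp add: linear_add[OF lin] linear_scale[OF lin] field_simps)
qed

section \<open>Representing an extreme point by an ultrafilter\<close>

lemma extreme_point_in_\<M>tilde:
  assumes ext: "\<psi> extreme_point_of \<M>"
  shows "\<psi> \<in> \<M>tilde"
proof -
  have \<psi>: "\<psi> \<in> \<M>"
    using ext by (simp add: extreme_point_of_def)
  note lin = \<M>_linear[OF \<psi>]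
  \<comment> \<open>Contains the squares of all \<open>f - \<psi> f\<close>; nonnegativity lets a
    sum control its summands.\<close>
  define Z where "Z = {h. \<psi> h = 0 \<and> (\<forall>x. average h x \<ge> 0)}"
  \<comment> \<open>The coarsest filter at infinity along which the average of \<open>h\<close>
    tends to 0.\<close>
  define G where "G h = inf at_top (filtercomap (average h) (nhds 0))" for h
  have G_lim: "(average h \<longlongrightarrow> 0) F \<longleftrightarrow> F \<le> G h" if "F \<le> at_top" for h F
    using that by (simp add: G_def filterlim_iff_le_filtercomap)
  \<comment> \<open>Otherwise the average of \<open>h\<close> would eventually exceed some
    \<open>e > 0\<close>, forcing \<open>\<psi> h >= e\<close>.\<close>
  have "G h \<noteq> bot" if h: "h \<in> Z" for h
  proof
    assume "G h = bot"
    then have "eventually (\<lambda>x. False) (G h)"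
      by simp
    then obtain P Q where P: "eventually P at_top" and Q: "eventually Q (nhds 0)"
      and PQ: "\<And>x. P x \<Longrightarrow> Q (average h x) \<Longrightarrow> False"
      unfolding G_def eventually_inf eventually_filtercomap by blast
    from Q obtain e where e: "e > 0" "\<And>y. dist y 0 < e \<Longrightarrow> Q y"
      unfolding eventually_nhds_metric by blast
    have "\<forall>\<^sub>F x in at_top. e \<le> average h x"
      using P
    proof eventually_elim
      case (elim x)
      then have "\<not> dist (average h x) 0 < e"
        using PQ e(2) by blast
      then show ?case
        using h by (simp add: Z_def)
    qed
    then have "e \<le> \<psi> h"
      by (rule \<M>_ge[OF \<psi> _ tendsto_const])
    with h e show False
      by (simp add: Z_def)
  qed
  \<comment> \<open>The sum \<open>h1 + h2\<close> dominates both summands, so the filters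
    \<open>G h\<close> are directed and their infimum is proper.\<close>
  moreover have "\<exists>k\<in>Z. G k \<le> inf (G h1) (G h2)" if "h1 \<in> Z" "h2 \<in> Z" for h1 h2
  proof (rule bexI)
    show k: "h1 + h2 \<in> Z"
      using that by (simp add: Z_def linear_add[OF lin] average_add)
    have lim: "(average (h1 + h2) \<longlongrightarrow> 0) (G (h1 + h2))"
      by (subst G_lim) (simp_all add: G_def)
    have "(average h \<longlongrightarrow> 0) (G (h1 + h2))" if "h \<in> {h1, h2}" for h
      by (rule tendsto_sandwich[OF _ _ tendsto_const lim])
        (use that \<open>h1 \<in> Z\<close> \<open>h2 \<in> Z\<close> in \<open>auto simp: Z_def average_add\<close>)
    then show "G (h1 + h2) \<le> inf (G h1) (G h2)"
      by (simp add: G_lim G_def[of "h1 + h2"])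
  qed
  ultimately have "(INF h\<in>Z. G h) \<noteq> bot"
    by (subst INF_filter_bot_base) blast+
  then obtain U where U: "U \<noteq> bot" "U \<le> (INF h\<in>Z. G h)"
    and ultra: "\<And>A. eventually (\<lambda>x. x \<in> A) U \<or> eventually (\<lambda>x. x \<notin> A) U"
    by (rule exists_ultrafilter_le) (rule that)
  \<comment> \<open>Some member of \<open>Z\<close> is required to place the infimum below
    \<open>at_top\<close>.\<close>
  have "0 \<in> Z"
    using average_scaleR[of 0 0] by (simp add: Z_def linear_0[OF lin])
  then have top: "U \<le> at_top"
    using U(2) by (auto simp: G_def le_INF_iff)
  have 1: "eventually (\<lambda>x. x \<in> {1..}) U"
    using filter_leD[OF top eventually_ge_at_top[of 1]] by simp
  have "ultrafilter_on {1..} U"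
    unfolding ultrafilter_on_def
  proof (intro conjI allI impI)
    fix A :: "real set"
    show "eventually (\<lambda>x. x \<in> A) U \<or> eventually (\<lambda>x. x \<in> {1..} - A) U"
      using ultra[of A] 1 by (auto simp: eventually_conj_iff)
  qed (use U 1 in \<open>simp_all add: le_principal\<close>)
  moreover have "\<not> eventually (\<lambda>x. x \<in> B) U" if bdd: "bounded B" for B
  proof
    assume B: "eventually (\<lambda>x. x \<in> B) U"
    obtain c where c: "\<And>x. x \<in> B \<Longrightarrow> \<bar>x\<bar> \<le> c"
      using bdd by (auto simp: bounded_iff)
    have "eventually (\<lambda>x. c < x) U"
      by (rule filter_leD[OF top eventually_gt_at_top])
    with B have "eventually (\<lambda>x. False) U"
      by eventually_elim (use c in force)
    with U show False
      by (simp add: trivial_limit_def)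
  qed
  moreover have "ultralimit_mean U = \<psi>"
  proof
    fix f
    define g where "g = f - \<psi> f *\<^sub>R one_linf"
    have "\<psi> g = 0"
      by (simp add: g_def linear_diff[OF lin] linear_scale[OF lin] \<M>_one[OF \<psi>])
    then have "prod_linf g g \<in> Z"
      by (simp add: Z_def extreme_point_multiplicative[OF ext] average_prod)
    then have "U \<le> G (prod_linf g g)"
      using U(2) by (simp add: le_INF_iff)
    then have "(average (prod_linf g g) \<longlongrightarrow> 0) U"
      using G_lim[OF top] by simp
    then have "((\<lambda>x. (average g x)\<^sup>2) \<longlongrightarrow> 0) U"
      by (simp add: average_prod[abs_def] power2_eq_square)
    then have "(average g \<longlongrightarrow> 0) U"
      by simp
    then have "((\<lambda>x. average g x + \<psi> f * average one_linf x) \<longlongrightarrow> 0 + \<psi> f * 1) U"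
      by (intro tendsto_intros tendsto_average_one_le[OF top])
    then have "(average f \<longlongrightarrow> \<psi> f) U"
      by (simp add: g_def average_simps)
    then show "ultralimit_mean U f = \<psi> f"
      unfolding ultralimit_mean_def using U(1) by (intro tendsto_Lim) auto
  qed
  ultimately show ?thesis
    unfolding \<M>tilde_def by blast
qed

theorem theorem4p2:
  shows "\<M>tilde = {\<psi>. \<psi> extreme_point_of \<M>}"
proof (intro set_eqI iffI)
  fix \<psi> assume "\<psi> \<in> \<M>tilde"
  then show "\<psi> \<in> {\<psi>. \<psi> extreme_point_of \<M>}"
    unfolding \<M>tilde_def using ultralimit_mean_extreme \<M>tilde_filter_le_at_top by blast
qed (use extreme_point_in_\<M>tilde in blast)

end
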